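(* Let $d \ge 1$ be an integer and let $0 < p < q < \infty$ satisfy $\frac1d > \frac1p - \frac1q$. Then \[ \inf_{N \ge 1} N^{1/p - 1/q}\, \overline e_{N;d,p,q} > 0, \] where the infimum is over integers $N \ge 1$ and \[ \overline e_{N;d,p,q} := \sup\left\{ e_{N;d,p}(\mu) : \mu \in \mathcal P(\mathbb R^d),\ \mathcal M_q(\mu)^{1/q} \le 1 \right\}. \]
   Context: $\mathcal P(\mathbb R^d)$ is the set of Borel probability measures on $\mathbb R^d$, and $|\cdot|$ is the Euclidean norm. For $0 < p < \infty$, $\mathcal M_p(\mu) := \int_{\mathbb R^d} |x|^p\, \mu(dx)$ and $\mathcal P_p(\mathbb R^d) := \{\mu \in \mathcal P(\mathbb R^d) : \mathcal M_p(\mu) < \infty\}$. For $0<p<\infty$ and $\mu,\nu \in \mathcal P_p(\mathbb R^d)$, \[ \mathcal W_p(\mu,\nu) := \inf_{\gamma \in \Gamma(\mu,\nu)} \left( \iint_{\mathbb R^d\times\mathbb R^d} |x-y|^p\, \gamma(dx,dy) \right)^{1/p}, \] where $\Gamma(\mu,\nu)$ is the set of probability measures on $\mathbb R^d \times \mathbb R^d$ with first marginal $\mu$ and second marginal $\nu$ (values $p<1$ are allowed, with the same formula). For an integer $N \ge 1$, \[ e_{N;d,p}(\mu) := \inf_{(x_1,\dots,x_N) \in (\mathbb R^d)^N} \mathcal W_p\Big(\mu, \frac1N \sum_{i=1}^N \delta_{x_i}\Big). \] *)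

theory Defs
  imports "HOL-Probability.Probability"
begin

text \<open>
  Moments, transport costs and quantization errors take values in \<^typ>\<open>ennreal\<close>, so that every
  infimum and supremum below is taken in a complete lattice and no integrability convention
  for divergent integrals interferes.
\<close>

definition ennreal_powr :: "ennreal \<Rightarrow> real \<Rightarrow> ennreal" where
  \<comment> \<open>only meant for exponents \<open>r > 0\<close>, where \<open>\<infinity>\<close> is mapped to \<open>\<infinity>\<close>\<close>
  "ennreal_powr x r = (if x = \<top> then \<top> else ennreal (enn2real x powr r))"

definition borel_prob_measures :: "'a::topological_space measure set" where
  "borel_prob_measures = {\<mu>. prob_space \<mu> \<and> sets \<mu> = sets borel}"

definition moment :: "real \<Rightarrow> 'a::real_normed_vector measure \<Rightarrow> ennreal" where
  "moment p \<mu> = (\<integral>\<^sup>+ x. ennreal (norm x powr p) \<partial>\<mu>)"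

definition couplings ::
    "'a::topological_space measure \<Rightarrow> 'a measure \<Rightarrow> ('a \<times> 'a) measure set" where
  "couplings \<mu> \<nu> =
     {\<gamma> \<in> borel_prob_measures. distr \<gamma> borel fst = \<mu> \<and> distr \<gamma> borel snd = \<nu>}"

text \<open>
  The distance \<open>W\<^sub>p\<close> is not restricted to measures with finite \<open>p\<close>-th moment: on
  other measures the same formula is used, possibly with value \<open>\<infinity>\<close>.
\<close>

definition wasserstein ::
    "real \<Rightarrow> 'a::real_normed_vector measure \<Rightarrow> 'a measure \<Rightarrow> ennreal" where
  "wasserstein p \<mu> \<nu> =
     (INF \<gamma> \<in> couplings \<mu> \<nu>.
        ennreal_powr (\<integral>\<^sup>+ (x, y). ennreal (norm (x - y) powr p) \<partial>\<gamma>) (1 / p))"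

definition empirical_measure :: "nat \<Rightarrow> (nat \<Rightarrow> 'a::topological_space) \<Rightarrow> 'a measure" where
  "empirical_measure N x =
     measure_of UNIV (sets borel) (\<lambda>A. (\<Sum>i = 1..N. emeasure (return borel (x i)) A) / of_nat N)"

text \<open>
  \<^const>\<open>measure_of\<close> yields the null measure if the given set function is not a measure;
  the next two facts exclude this.
\<close>

lemma emeasure_empirical_measure:
  assumes "A \<in> sets borel"
  shows "emeasure (empirical_measure N x) A =
    (\<Sum>i = 1..N. emeasure (return borel (x i)) A) / of_nat N"
proof -
  let ?f = "\<lambda>A. (\<Sum>i = 1..N. emeasure (return borel (x i)) A) / of_nat N"
  have ca: "countably_additive (sets borel) ?f"
  proof (rule countably_additiveI)
    fix B :: "nat \<Rightarrow> 'a set"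
    assume B: "range B \<subseteq> sets borel" "disjoint_family B" "(\<Union>i. B i) \<in> sets borel"
    have "(\<Sum>n. ?f (B n)) = (\<Sum>n. \<Sum>i = 1..N. emeasure (return borel (x i)) (B n)) / of_nat N"
      by (simp add: ennreal_suminf_divide)
    also have "(\<Sum>n. \<Sum>i = 1..N. emeasure (return borel (x i)) (B n))
        = (\<Sum>i = 1..N. \<Sum>n. emeasure (return borel (x i)) (B n))"
      by (rule suminf_sum) simp
    also have "\<dots> = (\<Sum>i = 1..N. emeasure (return borel (x i)) (\<Union>n. B n))"
      using B by (intro sum.cong refl suminf_emeasure) auto
    finally show "(\<Sum>n. ?f (B n)) = ?f (\<Union>n. B n)" .
  qed
  have pos: "positive (sets borel) ?f"
    by (simp add: positive_def)
  have "sigma_algebra (UNIV :: 'a set) (sets borel)"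
    using sets.sigma_algebra_axioms[of "borel :: 'a measure"] by simp
  then show ?thesis
    unfolding empirical_measure_def
    by (rule emeasure_measure_of_sigma[OF _ pos ca assms])
qed

lemma empirical_measure_in_borel_prob_measures:
  assumes "N \<ge> 1"
  shows "empirical_measure N x \<in> borel_prob_measures"
proof -
  have sp: "space (empirical_measure N x) = UNIV"
    by (simp add: empirical_measure_def space_measure_of_conv)
  have "sets (empirical_measure N x) = sets borel"
    unfolding empirical_measure_def
    using sets.sigma_sets_eq[of "borel :: 'a measure"] by (simp add: sets_measure_of_conv)
  moreover have "emeasure (empirical_measure N x) UNIV = 1"
    using assms by (simp add: emeasure_empirical_measure ennreal_of_nat_eq_real_of_nat divide_ennreal)
  ultimately show ?thesis
    unfolding borel_prob_measures_def by (auto intro!: prob_spaceI simp: sp)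
qed

definition quantization_error ::
    "nat \<Rightarrow> real \<Rightarrow> 'a::real_normed_vector measure \<Rightarrow> ennreal" where
  \<comment> \<open>an \<open>N\<close>-tuple of points is a function on \<open>nat\<close>, of which only the values at \<open>1, \<dots>, N\<close> matter\<close>
  "quantization_error N p \<mu> =
     (INF x :: nat \<Rightarrow> 'a. wasserstein p \<mu> (empirical_measure N x))"

definition worst_quantization_error ::
    "'n::finite itself \<Rightarrow> nat \<Rightarrow> real \<Rightarrow> real \<Rightarrow> ennreal" where
  \<comment> \<open>the type argument fixes the space \<open>\<real>\<^sup>d\<close>, with \<open>d\<close> the cardinality of \<open>'n\<close>\<close>
  "worst_quantization_error _ N p q =
     (SUP \<mu> \<in> {\<mu> :: (real ^ 'n) measure.
        \<mu> \<in> borel_prob_measures \<and> ennreal_powr (moment q \<mu>) (1 / q) \<le> 1}.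
        quantization_error N p \<mu>)"

end

theory Submission
  imports Defs
begin

text \<open>
  Test against the measure with mass \<open>1/(2N)\<close> at a point of norm \<open>R = (2N)\<^bsup>1/q\<^esup>\<close> and the remaining
  mass at the origin; its \<open>q\<close>-th moment is \<open>1\<close>. An empirical measure with \<open>N\<close> atoms gives the
  ball of radius \<open>R/2\<close> around the far point either no mass or at least \<open>1/N\<close>, so a mass of at
  least \<open>1/(2N)\<close> has to travel a distance of at least \<open>R/2\<close>.
\<close>

text \<open>Encoded as an empirical measure of \<open>2 * N\<close> points, all but one at the
  origin, so that the measure axioms and the values on Borel sets come from the facts about
  \<open>empirical_measure\<close>.\<close>

definition spike_measure :: "nat \<Rightarrow> 'a::real_normed_vector \<Rightarrow> 'a measure" where
  "spike_measure N z = empirical_measure (2 * N) (\<lambda>i. if i = 1 then z else 0)"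

lemma ennreal_powr_mono:
  assumes "x \<le> y" and "0 \<le> r"
  shows "ennreal_powr x r \<le> ennreal_powr y r"
\<comment> \<open>\<open>enn2real\<close> sends \<open>\<top>\<close> to 0 and is monotone only
  below a finite bound, so an infinite \<open>y\<close> is treated apart.\<close>
proof (cases "y = \<top>")
  case False
  then show ?thesis
    using assms by (auto simp: ennreal_powr_def top_unique less_top
        intro!: ennreal_leI powr_mono2 enn2real_mono)
qed (simp add: ennreal_powr_def)

lemma ennreal_powr_ennreal:
  "0 \<le> a \<Longrightarrow> ennreal_powr (ennreal a) r = ennreal (a powr r)"
  by (simp add: ennreal_powr_def)

lemma ennreal_inverse_of_nat:
  "1 \<le> n \<Longrightarrow> 1 / of_nat n = ennreal (1 / real n)"
  by (simp add: ennreal_of_nat_eq_real_of_nat divide_ennreal flip: ennreal_1)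

lemma spike_measure_in_borel_prob_measures:
  "1 \<le> N \<Longrightarrow> spike_measure N z \<in> borel_prob_measures"
  unfolding spike_measure_def by (rule empirical_measure_in_borel_prob_measures) simp

lemma emeasure_spike_measure:
  assumes N: "1 \<le> N" and z: "z \<noteq> 0"
  shows "emeasure (spike_measure N z) {z} = ennreal (1 / (2 * real N))"
    and "emeasure (spike_measure N z) (- {0, z}) = 0"
proof -
  let ?x = "\<lambda>i::nat. if i = 1 then z else 0"
  have "(\<Sum>i = 1..2 * N. emeasure (return borel (?x i)) {z}) =
      (\<Sum>i = 1..2 * N. if i = 1 then 1 else 0)"
    using z by (intro sum.cong) auto
  also have "\<dots> = (1 :: ennreal)"
    using N by simp
  finally show "emeasure (spike_measure N z) {z} = ennreal (1 / (2 * real N))"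
    using N ennreal_inverse_of_nat[of "2 * N"]
    by (simp add: spike_measure_def emeasure_empirical_measure)
  have "- {0, z} \<in> sets borel"
    by (intro borel_open open_Compl finite_imp_closed) simp
  then show "emeasure (spike_measure N z) (- {0, z}) = 0"
    by (simp add: spike_measure_def emeasure_empirical_measure)
qed

lemma moment_spike_measure:
  assumes N: "1 \<le> N" and z: "z \<noteq> 0"
  shows "moment q (spike_measure N z) = ennreal (norm z powr q / (2 * real N))"
proof -
  let ?\<mu> = "spike_measure N z"
  have sets: "sets ?\<mu> = sets borel"
    using spike_measure_in_borel_prob_measures[OF N, of z] by (simp add: borel_prob_measures_def)
  have space: "space ?\<mu> = UNIV"
    using sets_eq_imp_space_eq[OF sets] by simp
  have "- {0, z} \<in> sets ?\<mu>"
    unfolding sets by (intro borel_open open_Compl finite_imp_closed) simp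
  then have "AE x in ?\<mu>. x \<in> {0, z}"
    using emeasure_spike_measure(2)[OF N z] by (intro AE_I[where N = "- {0, z}"]) auto
  \<comment> \<open>The atom at the origin drops out because \<open>0 powr q = 0\<close>, by
    convention for every real \<open>q\<close>.\<close>
  then have "moment q ?\<mu> = (\<integral>\<^sup>+ x. ennreal (norm z powr q) * indicator {z} x \<partial>?\<mu>)"
    unfolding moment_def by (intro nn_integral_cong_AE) (auto simp: z indicator_def)
  also have "\<dots> = ennreal (norm z powr q) * emeasure ?\<mu> {z}"
    by (intro nn_integral_cmult_indicator) (simp add: sets)
  also have "\<dots> = ennreal (norm z powr q / (2 * real N))"
    using emeasure_spike_measure(1)[OF N z] by (simp flip: ennreal_mult)
  finally show ?thesis .
qed

text \<open>Each atom contributes \<open>1/N\<close>, so no mass lies strictly between 0 and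
  \<open>1/N\<close>. The spike mass \<open>1/(2N)\<close> is the midpoint of this gap, hence off by
  at least \<open>1/(2N)\<close> either way.\<close>

lemma emeasure_empirical_measure_dichotomy:
  assumes N: "1 \<le> N" and B: "B \<in> sets borel"
  shows "emeasure (empirical_measure N x) B = 0 \<or>
    ennreal (1 / real N) \<le> emeasure (empirical_measure N x) B"
proof (cases "\<exists>i\<in>{1..N}. x i \<in> B")
  case True
  then obtain i where i: "i \<in> {1..N}" "x i \<in> B" by blast
  have "emeasure (return borel (x i)) B \<le> (\<Sum>i = 1..N. emeasure (return borel (x i)) B)"
    using i(1) by (intro member_le_sum) auto
  then have "1 / of_nat N \<le> emeasure (empirical_measure N x) B"
    using i B by (simp add: emeasure_empirical_measure divide_right_mono_ennreal)
  then show ?thesis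
    using N by (simp add: ennreal_inverse_of_nat)
next
  case False
  then show ?thesis
    using B by (simp add: emeasure_empirical_measure)
qed

lemma emeasure_coupling_marginals:
  assumes \<gamma>: "\<gamma> \<in> couplings \<mu> \<nu>" and A: "A \<in> sets borel"
  shows "emeasure \<mu> A = emeasure \<gamma> (fst -` A)" and "fst -` A \<in> sets \<gamma>"
    and "emeasure \<nu> A = emeasure \<gamma> (snd -` A)" and "snd -` A \<in> sets \<gamma>"
proof -
  have sets: "sets \<gamma> = sets borel"
    and marg: "distr \<gamma> borel fst = \<mu>" "distr \<gamma> borel snd = \<nu>"
    using \<gamma> by (auto simp: couplings_def borel_prob_measures_def)
  have space: "space \<gamma> = UNIV"
    using sets_eq_imp_space_eq[OF sets] by simp
  \<comment> \<open>\<open>\<gamma>\<close> lives on the Borel sets of the product space, which may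
    exceed the product sigma-algebra without second countability; continuity of the projections
    gives measurability directly.\<close>
  have fst: "fst \<in> measurable \<gamma> borel" and snd: "snd \<in> measurable \<gamma> borel"
    unfolding measurable_cong_sets[OF sets refl]
    by (intro borel_measurable_continuous_onI continuous_intros)+
  show "emeasure \<mu> A = emeasure \<gamma> (fst -` A)" "emeasure \<nu> A = emeasure \<gamma> (snd -` A)"
    using A fst snd by (simp_all add: emeasure_distr space flip: marg)
  show "fst -` A \<in> sets \<gamma>" "snd -` A \<in> sets \<gamma>"
    using measurable_sets[OF fst A] measurable_sets[OF snd A] by (simp_all add: space)
qed

text \<open>If the ball around \<open>z\<close> has no target mass, all mass at \<open>z\<close>
  must leave it. Otherwise the ball receives at least \<open>1/N\<close>, of which \<open>z\<close>
  supplies at most half, and the rest comes from the origin.\<close>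

lemma coupling_spike_measure_far:
  fixes z :: "'a::real_normed_vector"
  assumes N: "1 \<le> N" and z: "z \<noteq> 0"
    and \<gamma>: "\<gamma> \<in> couplings (spike_measure N z) (empirical_measure N x)"
  shows "ennreal (1 / (2 * real N)) \<le> emeasure \<gamma> {(x, y). norm z / 2 \<le> norm (x - y)}"
    (is "?m \<le> emeasure \<gamma> ?S")
    and "{(x, y). norm z / 2 \<le> norm (x - y)} \<in> sets \<gamma>"
proof -
  let ?B = "ball z (norm z / 2)"
  let ?Z = "- {0, z}"
  have sets: "sets \<gamma> = sets borel"
    using \<gamma> by (auto simp: couplings_def borel_prob_measures_def)
  have "closed ?S"
    by (auto simp: case_prod_unfold intro!: closed_Collect_le continuous_intros)
  then show S: "?S \<in> sets \<gamma>"
    unfolding sets by (rule borel_closed)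
  have zb: "{z} \<in> sets borel" and Bb: "?B \<in> sets borel" and Zb: "?Z \<in> sets borel"
    by (auto intro!: borel_open open_Compl finite_imp_closed)
  note fz = emeasure_coupling_marginals(1,2)[OF \<gamma> zb]
    and fZ = emeasure_coupling_marginals(1,2)[OF \<gamma> Zb]
    and sB = emeasure_coupling_marginals(3,4)[OF \<gamma> Bb]
  from emeasure_empirical_measure_dichotomy[OF N Bb] show "?m \<le> emeasure \<gamma> ?S"
  proof
    assume B0: "emeasure (empirical_measure N x) ?B = 0"
    have "?m = emeasure \<gamma> (fst -` {z})"
      using emeasure_spike_measure(1)[OF N z] fz by simp
    \<comment> \<open>A pair starting at \<open>z\<close> either ends in the ball or has moved by at
      least its radius.\<close>
    also have "\<dots> \<le> emeasure \<gamma> (?S \<union> snd -` ?B)"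
      using S sB(2) by (intro emeasure_mono) (auto simp: dist_norm)
    also have "\<dots> \<le> emeasure \<gamma> ?S + emeasure \<gamma> (snd -` ?B)"
      using S sB(2) by (rule emeasure_subadditive)
    also have "\<dots> = emeasure \<gamma> ?S"
      using B0 sB(1) by simp
    finally show ?thesis .
  next
    assume B1: "ennreal (1 / real N) \<le> emeasure (empirical_measure N x) ?B"
    \<comment> \<open>This puts every pair from the origin into the ball inside
      \<open>?S\<close>.\<close>
    have far: "norm z / 2 \<le> norm y" if "y \<in> ?B" for y
      using that norm_triangle_ineq2[of z y] by (simp add: dist_norm)
    \<comment> \<open>One copy of \<open>?m\<close> will match the mass starting at \<open>z\<close>
      and be cancelled at the end, which is legitimate since \<open>?m\<close> is finite.\<close>
    have "?m + ?m = ennreal (1 / real N)"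
      using N by (simp flip: ennreal_plus)
    also have "\<dots> \<le> emeasure \<gamma> (snd -` ?B)"
      using B1 sB(1) by simp
    \<comment> \<open>Sort the pairs ending in the ball by source: those from 0 lie in
      \<open>?S\<close>, and those from \<open>?Z\<close> form a null set.\<close>
    also have "\<dots> \<le> emeasure \<gamma> (?S \<union> (fst -` {z} \<union> fst -` ?Z))"
      using S fz(2) fZ(2) far by (intro emeasure_mono) auto
    also have "\<dots> \<le> emeasure \<gamma> ?S + (emeasure \<gamma> (fst -` {z}) + emeasure \<gamma> (fst -` ?Z))"
      using S fz(2) fZ(2)
      by (intro order_trans[OF emeasure_subadditive] add_mono emeasure_subadditive) auto
    also have "\<dots> = ?m + emeasure \<gamma> ?S"
      using emeasure_spike_measure[OF N z] fz(1) fZ(1) by (simp add: add.commute)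
    finally show ?thesis
      by (simp add: ennreal_add_left_cancel_le)
  qed
qed

text \<open>Markov's inequality for an arbitrary coupling: the cost is at least
  \<open>(norm z / 2) powr p\<close> on a set of mass at least \<open>1/(2N)\<close>. Taking the
  \<open>p\<close>-th root gives the bound.\<close>

lemma quantization_error_spike_measure_ge:
  fixes z :: "'a::real_normed_vector"
  assumes N: "1 \<le> N" and z: "z \<noteq> 0" and p: "0 < p"
  shows "ennreal (norm z / 2 * (2 * real N) powr (- 1 / p)) \<le>
    quantization_error N p (spike_measure N z)"
  unfolding quantization_error_def wasserstein_def
proof (intro INF_greatest)
  fix x \<gamma> assume \<gamma>: "\<gamma> \<in> couplings (spike_measure N z) (empirical_measure N x)"
  let ?S = "{(x, y). norm z / 2 \<le> norm (x - y)} :: ('a \<times> 'a) set"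
  let ?c = "(norm z / 2) powr p"
  note S = coupling_spike_measure_far[OF N z \<gamma>]
  have "ennreal (?c * (1 / (2 * real N))) \<le> ennreal ?c * emeasure \<gamma> ?S"
    using S(1) by (simp only: ennreal_mult' powr_ge_zero mult_left_mono zero_le)
  also have "\<dots> = (\<integral>\<^sup>+ w. ennreal ?c * indicator ?S w \<partial>\<gamma>)"
    using S(2) by (rule nn_integral_cmult_indicator[symmetric])
  also have "\<dots> \<le> (\<integral>\<^sup>+ (x, y). ennreal (norm (x - y) powr p) \<partial>\<gamma>)"
    using p by (intro nn_integral_mono) (auto simp: indicator_def intro!: ennreal_leI powr_mono2)
  finally have "ennreal_powr (ennreal (?c * (1 / (2 * real N)))) (1 / p) \<le>
      ennreal_powr (\<integral>\<^sup>+ (x, y). ennreal (norm (x - y) powr p) \<partial>\<gamma>) (1 / p)"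
    using p by (intro ennreal_powr_mono) auto
  moreover have "(?c * (1 / (2 * real N))) powr (1 / p) =
      norm z / 2 * (2 * real N) powr (- 1 / p)"
    using p by (simp add: powr_mult powr_powr powr_divide powr_minus_divide)
  moreover have "0 \<le> ?c * (1 / (2 * real N))" by simp
  ultimately show "ennreal (norm z / 2 * (2 * real N) powr (- 1 / p)) \<le>
      ennreal_powr (\<integral>\<^sup>+ (x, y). ennreal (norm (x - y) powr p) \<partial>\<gamma>) (1 / p)"
    by (simp only: ennreal_powr_ennreal)
qed

lemma worst_quantization_error_ge:
  assumes N: "1 \<le> N" and p: "0 < p" and q: "0 < q"
  shows "ennreal ((2 * real N) powr (1 / q - 1 / p) / 2) \<le>
    worst_quantization_error TYPE('n::finite) N p q"
proof -
  \<comment> \<open>The largest norm allowed by the moment constraint: the \<open>q\<close>-th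
    moment \<open>R powr q / (2 * real N)\<close> is exactly 1.\<close>
  define R where "R = (2 * real N) powr (1 / q)"
  have R: "0 < R"
    using N by (simp add: R_def)
  then obtain z :: "real ^ 'n" where nz: "norm z = R"
    using vector_choose_size[of R] by auto
  with R have z: "z \<noteq> 0" by auto
  have "moment q (spike_measure N z) = 1"
    using N q by (simp add: moment_spike_measure[OF N z] nz R_def powr_powr)
  then have "ennreal_powr (moment q (spike_measure N z)) (1 / q) \<le> 1"
    by (simp add: ennreal_powr_def)
  then have "quantization_error N p (spike_measure N z) \<le> worst_quantization_error TYPE('n) N p q"
    unfolding worst_quantization_error_def
    using spike_measure_in_borel_prob_measures[OF N] by (intro SUP_upper) auto
  moreover have "norm z / 2 * (2 * real N) powr (- 1 / p) = (2 * real N) powr (1 / q - 1 / p) / 2"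
    unfolding nz R_def by (simp add: powr_diff powr_minus_divide)
  ultimately show ?thesis
    using quantization_error_spike_measure_ge[OF N z p] by (auto intro: order_trans)
qed

theorem proposition3p1:
  fixes p q :: real
  assumes "0 < p" and "p < q"
    and "1 / real CARD('n::finite) > 1 / p - 1 / q"
  shows "(INF N \<in> {1::nat..}.
    ennreal (real N powr (1 / p - 1 / q)) * worst_quantization_error TYPE('n) N p q) > 0"
proof -
  define s where "s = 1 / p - 1 / q"
  \<comment> \<open>The powers of \<open>N\<close> cancel exactly. What remains is
    \<open>2 powr (- s)\<close> from the \<open>2 * N\<close> points of the spike measure and
    \<open>1/2\<close> from the radius of the ball.\<close>
  have "ennreal (2 powr (- s) / 2) \<le>
      (INF N \<in> {1::nat..}. ennreal (real N powr s) * worst_quantization_error TYPE('n) N p q)"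
  proof (rule INF_greatest)
    fix N :: nat assume "N \<in> {1..}"
    then have N: "1 \<le> N" by simp
    have "2 powr (- s) / 2 = real N powr s * ((2 * real N) powr (1 / q - 1 / p) / 2)"
    proof -
      have "1 / q - 1 / p = - s" by (simp add: s_def)
      then show ?thesis
        using N by (simp add: powr_mult powr_minus)
    qed
    then have "ennreal (2 powr (- s) / 2) =
        ennreal (real N powr s) * ennreal ((2 * real N) powr (1 / q - 1 / p) / 2)"
      by (simp only: ennreal_mult' powr_ge_zero)
    also have "\<dots> \<le> ennreal (real N powr s) * worst_quantization_error TYPE('n) N p q"
      using assms by (intro mult_left_mono worst_quantization_error_ge[OF N]) auto
    finally show "ennreal (2 powr (- s) / 2) \<le>
        ennreal (real N powr s) * worst_quantization_error TYPE('n) N p q" .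
  qed
  moreover have "0 < ennreal (2 powr (- s) / 2)" by simp
  ultimately show ?thesis
    unfolding s_def by (rule less_le_trans[rotated])
qed

end
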